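(* Consider the second-stage problem of the Generalized Ordinal Priority Approach (GOPA) in hybrid prospects: $$\begin{aligned}\max_{\mathbf w,z}\ & z\\ \text{s.t. }& U^*_{ij}(r)\,z\le\frac{t_is_{ij}w_{ijr}}{K_{ij}} &&\forall(i,j,r)\in\mathcal U^1,\\ &\frac{\int_0^ru^*_{ij}(K_{ij}-x)\,dx}{\sum_{r'=1}^{K_{ij}}\int_0^{r'}u^*_{ij}(K_{ij}-x)\,dx}\,z\le\frac{t_is_{ij}w_{ijr}}{K_{ij}} &&\forall(i,j,r)\in\mathcal U^2,\\ &\sum_{i=1}^I\sum_{j=1}^J\sum_{r=1}^{K_{ij}}c_{ijr}w_{ijr}=1,\\ & w_{ijr}\ge0 &&\forall(i,j,r)\in\mathcal U.\end{aligned}$$ Its analytical solution is given by $$z^*=1\Bigg/\Bigg(\sum_{i=1}^I\sum_{j=1}^J\sum_{r=1}^{K_{ij}}\frac{c_{ijr}K_{ij}U^*_{ijr}}{t_is_{ij}}\Bigg)$$ and $$w^*_{ijr}=\big(K_{ij}U^*_{ijr}\big)\Bigg/\Bigg(t_is_{ij}\sum_{i'=1}^I\sum_{j'=1}^J\sum_{r'=1}^{K_{i'j'}}\frac{c_{i'j'r'}K_{i'j'}U^*_{i'j'r'}}{t_{i'}s_{i'j'}}\Bigg),\qquad\forall(i,j,r)\in\mathcal U,$$ where $$U^*_{ijr}=\begin{cases}U^*_{ij}(r),&\forall(i,j,r)\in\mathcal U^1,\\ \Big(\int_0^ru^*_{ij}(K_{ij}-x)\,dx\Big)\Big/\Big(\sum_{r'=1}^{K_{ij}}\int_0^{r'}u^*_{ij}(K_{ij}-x)\,dx\Big),&\forall(i,j,r)\in\mathcal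 U^2.\end{cases}$$
   Context: $[n]=\{1,\dots,n\}$. There are $I$ experts, $J$ attributes and $K$ alternatives. $t_i\in[I]$ is the rank of expert $i$, $s_{ij}\in[J]$ the rank of attribute $j$ given by expert $i$, and $r_{ijk}\in[K]$ the rank of alternative $k$ under attribute $j$ given by expert $i$. $K_{ij}=\max_k r_{ijk}$, $\mathcal U=\{(i,j,r):i\in[I],j\in[J],r\in[K_{ij}]\}$, and $c_{ijr}$ is the frequency with which rank $r$ occurs on attribute $j$ as given by expert $i$. $\mathcal U^1$ and $\mathcal U^2$, with $\mathcal U^1\cup\mathcal U^2=\mathcal U$, are the sets of indices for which utilities are elicited in the first stage in discrete and in continuous prospects, respectively. The first stage elicits, for each expert–attribute pair, by minimizing cross-entropy utility relative to a target utility under partial preference constraints, either a discrete utility $U^*_{ij}(r)\ge0$, $r\in[K_{ij}]$, with $\sum_{r=1}^{K_{ij}}U^*_{ij}(r)=1$, or a utility density function $u^*_{ij}(x)\ge0$ on $[0,K_{ij}]$ with $\int_0^{K_{ij}}u^*_{ij}(x)\,dx=1$; in the second stage these are given data. The variables of the second-stage problem are $z$ and $\mathbf w=(w_{ijr})_{(i,j,r)\in\mathcal U}$, where $w_{ijr}$ is the weight of the alternative ranked $r$ under expert $i$ and attribute $j$. *)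

theory Defs
  imports "HOL-Analysis.Analysis"
begin

text \<open>
  Experts, attributes and alternatives are numbered from 1. Only the values of the fields at
  indices in these ranges matter. \<open>disc_util i j r\<close> is used for the triples in \<open>stage_disc\<close>, and
  the density \<open>dens_util i j\<close> for the triples in \<open>stage_cont\<close>.
\<close>

record gopa =
  experts :: nat
  attributes :: nat
  alternatives :: nat
  expert_rank :: "nat \<Rightarrow> nat"
  attr_rank :: "nat \<Rightarrow> nat \<Rightarrow> nat"
  alt_rank :: "nat \<Rightarrow> nat \<Rightarrow> nat \<Rightarrow> nat"
  stage_disc :: "(nat \<times> nat \<times> nat) set"
  stage_cont :: "(nat \<times> nat \<times> nat) set"
  disc_util :: "nat \<Rightarrow> nat \<Rightarrow> nat \<Rightarrow> real"
  dens_util :: "nat \<Rightarrow> nat \<Rightarrow> real \<Rightarrow> real"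

definition max_rank :: "gopa \<Rightarrow> nat \<Rightarrow> nat \<Rightarrow> nat" where
  "max_rank G i j = Max (alt_rank G i j ` {1..alternatives G})"

definition rank_freq :: "gopa \<Rightarrow> nat \<Rightarrow> nat \<Rightarrow> nat \<Rightarrow> nat" where
  "rank_freq G i j r = card {k \<in> {1..alternatives G}. alt_rank G i j k = r}"

definition indices :: "gopa \<Rightarrow> (nat \<times> nat \<times> nat) set" where
  "indices G = {(i, j, r). i \<in> {1..experts G} \<and> j \<in> {1..attributes G} \<and> r \<in> {1..max_rank G i j}}"

text \<open>
  The two closure conditions on \<open>stage_disc\<close> and \<open>stage_cont\<close> say that the kind of prospect is
  chosen once for each expert-attribute pair. Ranks may be tied.
\<close>

definition hybrid_gopa :: "gopa \<Rightarrow> bool" where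
  "hybrid_gopa G \<longleftrightarrow>
     1 \<le> experts G \<and> 1 \<le> attributes G \<and> 1 \<le> alternatives G \<and>
     (\<forall>i\<in>{1..experts G}. expert_rank G i \<in> {1..experts G}) \<and>
     (\<forall>i\<in>{1..experts G}. \<forall>j\<in>{1..attributes G}. attr_rank G i j \<in> {1..attributes G}) \<and>
     (\<forall>i\<in>{1..experts G}. \<forall>j\<in>{1..attributes G}. \<forall>k\<in>{1..alternatives G}.
        alt_rank G i j k \<in> {1..alternatives G}) \<and>
     stage_disc G \<union> stage_cont G = indices G \<and>
     stage_disc G \<inter> stage_cont G = {} \<and>
     (\<forall>(i, j, r)\<in>stage_disc G. \<forall>r'\<in>{1..max_rank G i j}. (i, j, r') \<in> stage_disc G) \<and>
     (\<forall>(i, j, r)\<in>stage_cont G. \<forall>r'\<in>{1..max_rank G i j}. (i, j, r') \<in> stage_cont G) \<and>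
     (\<forall>(i, j, r)\<in>stage_disc G.
        (\<forall>r'\<in>{1..max_rank G i j}. 0 \<le> disc_util G i j r') \<and>
        (\<Sum>r'=1..max_rank G i j. disc_util G i j r') = 1) \<and>
     (\<forall>(i, j, r)\<in>stage_cont G.
        (\<forall>x\<in>{0..real (max_rank G i j)}. 0 \<le> dens_util G i j x) \<and>
        (dens_util G i j has_integral 1) {0..real (max_rank G i j)})"

definition cont_util :: "gopa \<Rightarrow> nat \<Rightarrow> nat \<Rightarrow> nat \<Rightarrow> real" where
  "cont_util G i j r =
     integral {0..real r} (\<lambda>x. dens_util G i j (real (max_rank G i j) - x)) /
     (\<Sum>r'=1..max_rank G i j.
        integral {0..real r'} (\<lambda>x. dens_util G i j (real (max_rank G i j) - x)))"

definition feasible :: "gopa \<Rightarrow> (nat \<Rightarrow> nat \<Rightarrow> nat \<Rightarrow> real) \<Rightarrow> real \<Rightarrow> bool" where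
  "feasible G w z \<longleftrightarrow>
     (\<forall>(i, j, r)\<in>stage_disc G.
        disc_util G i j r * z
          \<le> real (expert_rank G i) * real (attr_rank G i j) * w i j r / real (max_rank G i j)) \<and>
     (\<forall>(i, j, r)\<in>stage_cont G.
        cont_util G i j r * z
          \<le> real (expert_rank G i) * real (attr_rank G i j) * w i j r / real (max_rank G i j)) \<and>
     (\<Sum>i=1..experts G. \<Sum>j=1..attributes G. \<Sum>r=1..max_rank G i j.
        real (rank_freq G i j r) * w i j r) = 1 \<and>
     (\<forall>(i, j, r)\<in>indices G. 0 \<le> w i j r)"

definition optimal :: "gopa \<Rightarrow> (nat \<Rightarrow> nat \<Rightarrow> nat \<Rightarrow> real) \<Rightarrow> real \<Rightarrow> bool" where
  "optimal G w z \<longleftrightarrow> feasible G w z \<and> (\<forall>w' z'. feasible G w' z' \<longrightarrow> z' \<le> z)"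

definition hybrid_util :: "gopa \<Rightarrow> nat \<Rightarrow> nat \<Rightarrow> nat \<Rightarrow> real" where
  "hybrid_util G i j r =
     (if (i, j, r) \<in> stage_disc G then disc_util G i j r else cont_util G i j r)"

definition total_util :: "gopa \<Rightarrow> real" where
  "total_util G =
     (\<Sum>i=1..experts G. \<Sum>j=1..attributes G. \<Sum>r=1..max_rank G i j.
        real (rank_freq G i j r) * real (max_rank G i j) * hybrid_util G i j r
          / (real (expert_rank G i) * real (attr_rank G i j)))"

definition z_star :: "gopa \<Rightarrow> real" where
  "z_star G = 1 / total_util G"

definition w_star :: "gopa \<Rightarrow> nat \<Rightarrow> nat \<Rightarrow> nat \<Rightarrow> real" where
  "w_star G i j r =
     real (max_rank G i j) * hybrid_util G i j r
       / (real (expert_rank G i) * real (attr_rank G i j) * total_util G)"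

end

theory Submission
  imports Defs
begin

text \<open>
  Every feasible pair satisfies \<open>K U z / (t s) \<le> w\<close> at each index. Multiplying by the frequency and
  summing gives \<open>T z \<le> 1\<close>, where \<open>T\<close> is the total utility, and equality forces equality at each
  index of positive frequency. The total \<open>T\<close> is positive when all frequencies are, because the
  normalized utilities of an expert-attribute pair sum to 1: in the continuous case the normalizing
  sum is at least its last term, the integral of the density over its whole domain.
\<close>

text \<open>Affine substitution with slope -1: the Jacobian has absolute value 1 and the interval is
  mapped onto itself.\<close>

lemma has_integral_reverse_real:
  fixes f :: "real \<Rightarrow> real"
  assumes "(f has_integral y) {0..a}"
  shows "((\<lambda>x. f (a - x)) has_integral y) {0..a}"
proof -
  have "((\<lambda>x. f (- x + a)) has_integral y) ((\<lambda>x. - x + a) ` {0..a})"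
    using has_integral_affinity[of f y 0 a "- 1" a] assms by simp
  moreover have "(\<lambda>x. - x + a) ` {0..a} = {0..a}"
    using image_diff_atLeastAtMost[of a 0 a] by simp
  ultimately show ?thesis
    by simp
qed

text \<open>By convention a non-integrable function has integral 0, which is nonnegative too. The
  lemma therefore applies directly to the reflected density on initial subintervals.\<close>

lemma integral_nonneg_of_nonneg:
  fixes f :: "'a::euclidean_space \<Rightarrow> real"
  assumes "\<And>x. x \<in> S \<Longrightarrow> 0 \<le> f x"
  shows "0 \<le> integral S f"
  using assms by (cases "f integrable_on S") (auto intro: integral_nonneg simp: not_integrable_integral)

lemma indices_eq_Sigma:
  "indices G = (SIGMA i:{1..experts G}. SIGMA j:{1..attributes G}. {1..max_rank G i j})"
  by (auto simp: indices_def)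

lemma finite_indices: "finite (indices G)"
  by (simp add: indices_eq_Sigma)

lemma sum_indices:
  "(\<Sum>i=1..experts G. \<Sum>j=1..attributes G. \<Sum>r=1..max_rank G i j. f i j r)
     = (\<Sum>(i, j, r)\<in>indices G. f i j r)"
  by (simp add: indices_eq_Sigma sum.Sigma)

context
  fixes G :: gopa
  assumes G: "hybrid_gopa G"
begin

lemma ranks_pos:
  assumes "(i, j, r) \<in> indices G"
  shows "0 < expert_rank G i" "0 < attr_rank G i j" "0 < max_rank G i j"
proof -
  have "i \<in> {1..experts G}" "j \<in> {1..attributes G}" "0 < max_rank G i j"
    using assms by (auto simp: indices_def)
  moreover from this have "expert_rank G i \<in> {1..experts G}" "attr_rank G i j \<in> {1..attributes G}"
    using G unfolding hybrid_gopa_def by blast+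
  ultimately show "0 < expert_rank G i" "0 < attr_rank G i j" "0 < max_rank G i j"
    by auto
qed

text \<open>The rank of alternative 1 is at least 1 and bounds the maximum from below. Hence every
  expert-attribute pair owns a triple with rank 1, to which the conditions on
  \<open>stage_disc\<close> and \<open>stage_cont\<close> can be applied.\<close>

lemma max_rank_pos:
  assumes "i \<in> {1..experts G}" "j \<in> {1..attributes G}"
  shows "0 < max_rank G i j"
proof -
  have "1 \<in> {1..alternatives G}"
    using G by (simp add: hybrid_gopa_def)
  moreover from this have "alt_rank G i j 1 \<in> {1..alternatives G}"
    using G assms unfolding hybrid_gopa_def by blast
  moreover have "alt_rank G i j 1 \<le> max_rank G i j"
    unfolding max_rank_def using \<open>1 \<in> _\<close> by (intro Max_ge) auto
  ultimately show ?thesis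
    by simp
qed

lemma cont_util_nonneg_sum:
  assumes "(i, j, r) \<in> stage_cont G"
  shows "\<forall>r'\<in>{1..max_rank G i j}. 0 \<le> cont_util G i j r'"
    and "(\<Sum>r'=1..max_rank G i j. cont_util G i j r') = 1"
proof -
  define K where "K = max_rank G i j"
  define F where "F r = integral {0..real r} (\<lambda>x. dens_util G i j (real K - x))" for r
  define D where "D = (\<Sum>r=1..K. F r)"
  have cont: "cont_util G i j r = F r / D" for r
    by (simp add: cont_util_def F_def D_def K_def)
  from assms G have "(i, j, r) \<in> indices G"
    unfolding hybrid_gopa_def by blast
  then have K: "0 < K"
    using ranks_pos by (simp add: K_def)
  have nonneg: "\<forall>x\<in>{0..real K}. 0 \<le> dens_util G i j x"
    and int: "(dens_util G i j has_integral 1) {0..real K}"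
    using G assms unfolding hybrid_gopa_def K_def by blast+
  \<comment> \<open>For \<open>x\<close> in \<open>[0, r]\<close> with \<open>r \<le> K\<close>, the
    point \<open>K - x\<close> stays in the domain of the density.\<close>
  have F_nonneg: "0 \<le> F r" if "r \<in> {1..K}" for r
    unfolding F_def using that nonneg by (intro integral_nonneg_of_nonneg) auto
  have "F K = 1"
    unfolding F_def using has_integral_reverse_real[OF int] by (rule integral_unique)
  moreover have "F K \<le> D"
    unfolding D_def using K F_nonneg by (intro member_le_sum) auto
  ultimately have D: "0 < D"
    by simp
  show "\<forall>r'\<in>{1..max_rank G i j}. 0 \<le> cont_util G i j r'"
    using D F_nonneg by (simp add: cont K_def)
  show "(\<Sum>r'=1..max_rank G i j. cont_util G i j r') = 1"
    using D unfolding cont K_def[symmetric] sum_divide_distrib[symmetric] D_def[symmetric] by simp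
qed

text \<open>By the closure conditions the triple with rank 1 decides the kind of prospect for all
  ranks of the pair, so \<open>hybrid_util\<close> agrees with a single normalized utility
  there.\<close>

lemma hybrid_util_nonneg_sum:
  assumes "i \<in> {1..experts G}" "j \<in> {1..attributes G}"
  shows "\<forall>r\<in>{1..max_rank G i j}. 0 \<le> hybrid_util G i j r"
    and "(\<Sum>r=1..max_rank G i j. hybrid_util G i j r) = 1"
proof -
  have "(i, j, 1) \<in> indices G"
    using assms max_rank_pos[OF assms] by (simp add: indices_def Suc_le_eq)
  then consider "(i, j, 1) \<in> stage_disc G" | "(i, j, 1) \<in> stage_cont G"
    using G unfolding hybrid_gopa_def by blast
  then have "(\<forall>r\<in>{1..max_rank G i j}. 0 \<le> hybrid_util G i j r) \<and>
    (\<Sum>r=1..max_rank G i j. hybrid_util G i j r) = 1"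
  proof cases
    case 1
    then have "\<forall>r\<in>{1..max_rank G i j}. (i, j, r) \<in> stage_disc G"
      using G unfolding hybrid_gopa_def by blast
    then have "\<forall>r\<in>{1..max_rank G i j}. hybrid_util G i j r = disc_util G i j r"
      by (simp add: hybrid_util_def)
    moreover have "\<forall>r\<in>{1..max_rank G i j}. 0 \<le> disc_util G i j r"
      and "(\<Sum>r=1..max_rank G i j. disc_util G i j r) = 1"
      using G 1 unfolding hybrid_gopa_def by blast+
    ultimately show ?thesis
      by simp
  next
    case 2
    then have "\<forall>r\<in>{1..max_rank G i j}. (i, j, r) \<notin> stage_disc G"
      using G unfolding hybrid_gopa_def by blast
    then have "\<forall>r\<in>{1..max_rank G i j}. hybrid_util G i j r = cont_util G i j r"
      by (simp add: hybrid_util_def)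
    with cont_util_nonneg_sum[OF 2] show ?thesis
      by simp
  qed
  then show "\<forall>r\<in>{1..max_rank G i j}. 0 \<le> hybrid_util G i j r"
    and "(\<Sum>r=1..max_rank G i j. hybrid_util G i j r) = 1"
    by blast+
qed

lemma hybrid_util_nonneg: "(i, j, r) \<in> indices G \<Longrightarrow> 0 \<le> hybrid_util G i j r"
  using hybrid_util_nonneg_sum(1) by (simp add: indices_def)

text \<open>The preference constraint solved for the weight: the least weight that it allows per
  unit of \<open>z\<close>.\<close>

definition index_coeff :: "nat \<Rightarrow> nat \<Rightarrow> nat \<Rightarrow> real" where
  "index_coeff i j r =
     real (max_rank G i j) * hybrid_util G i j r / (real (expert_rank G i) * real (attr_rank G i j))"

lemma index_coeff_nonneg: "(i, j, r) \<in> indices G \<Longrightarrow> 0 \<le> index_coeff i j r"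
  using hybrid_util_nonneg by (simp add: index_coeff_def)

lemma total_util_eq:
  "total_util G = (\<Sum>(i, j, r)\<in>indices G. real (rank_freq G i j r) * index_coeff i j r)"
  unfolding total_util_def sum_indices index_coeff_def by (simp add: mult.assoc)

lemma total_util_nonneg: "0 \<le> total_util G"
  unfolding total_util_eq by (intro sum_nonneg) (auto simp: index_coeff_nonneg)

text \<open>The candidate weights make every preference constraint tight.\<close>

lemma w_star_eq: "w_star G i j r = index_coeff i j r * z_star G"
  by (simp add: w_star_def index_coeff_def z_star_def)

lemma total_util_pos:
  assumes "\<forall>(i, j, r)\<in>indices G. 0 < rank_freq G i j r"
  shows "0 < total_util G"
proof -
  have one: "1 \<in> {1..experts G}" "1 \<in> {1..attributes G}"
    using G by (auto simp: hybrid_gopa_def)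
  \<comment> \<open>Utilities that sum to 1 cannot all vanish; the pair (1, 1) serves as a
    representative.\<close>
  obtain r where r: "r \<in> {1..max_rank G 1 1}" "hybrid_util G 1 1 r \<noteq> 0"
    using hybrid_util_nonneg_sum(2)[OF one] by (metis sum.neutral zero_neq_one)
  have idx: "(1, 1, r) \<in> indices G"
    using one r by (simp add: indices_def)
  have "0 < hybrid_util G 1 1 r"
    using hybrid_util_nonneg[OF idx] r by simp
  then have "0 < real (rank_freq G 1 1 r) * index_coeff 1 1 r"
    using assms idx ranks_pos[OF idx] by (auto simp: index_coeff_def)
  then show ?thesis
    unfolding total_util_eq using idx finite_indices
    by (intro sum_pos2[where i = "(1, 1, r)"]) (auto simp: index_coeff_nonneg)
qed

text \<open>The ranks are positive, so each constraint can be solved for its weight. Because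
  \<open>stage_disc\<close> and \<open>stage_cont\<close> partition the indices, the two families
  merge into one stated with \<open>hybrid_util\<close>.\<close>

lemma feasible_iff:
  "feasible G w z \<longleftrightarrow>
     (\<forall>(i, j, r)\<in>indices G. index_coeff i j r * z \<le> w i j r) \<and>
     (\<Sum>(i, j, r)\<in>indices G. real (rank_freq G i j r) * w i j r) = 1 \<and>
     (\<forall>(i, j, r)\<in>indices G. 0 \<le> w i j r)"
proof -
  have un: "indices G = stage_disc G \<union> stage_cont G" and dj: "stage_disc G \<inter> stage_cont G = {}"
    using G unfolding hybrid_gopa_def by blast+
  have constraint: "index_coeff i j r * z \<le> w i j r \<longleftrightarrow>
      hybrid_util G i j r * z
        \<le> real (expert_rank G i) * real (attr_rank G i j) * w i j r / real (max_rank G i j)"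
    if "(i, j, r) \<in> indices G" for i j r
    using ranks_pos[OF that] by (simp add: index_coeff_def field_simps)
  have disc: "hybrid_util G i j r = disc_util G i j r" if "(i, j, r) \<in> stage_disc G" for i j r
    using that by (simp add: hybrid_util_def)
  have cont: "hybrid_util G i j r = cont_util G i j r" if "(i, j, r) \<in> stage_cont G" for i j r
    using that dj by (auto simp: hybrid_util_def)
  have "(\<forall>(i, j, r)\<in>indices G. index_coeff i j r * z \<le> w i j r) \<longleftrightarrow>
     (\<forall>(i, j, r)\<in>stage_disc G. disc_util G i j r * z
          \<le> real (expert_rank G i) * real (attr_rank G i j) * w i j r / real (max_rank G i j)) \<and>
     (\<forall>(i, j, r)\<in>stage_cont G. cont_util G i j r * z
          \<le> real (expert_rank G i) * real (attr_rank G i j) * w i j r / real (max_rank G i j))"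
    unfolding un ball_Un using constraint disc cont un by (intro arg_cong2[where f = conj] ball_cong) auto
  then show ?thesis
    unfolding feasible_def sum_indices by blast
qed

lemma total_util_z_eq:
  "total_util G * z = (\<Sum>(i, j, r)\<in>indices G. real (rank_freq G i j r) * (index_coeff i j r * z))"
  unfolding total_util_eq sum_distrib_right by (intro sum.cong) auto

lemma feasible_upper_bound:
  assumes "feasible G w z"
  shows "total_util G * z \<le> 1"
proof -
  have "total_util G * z \<le> (\<Sum>(i, j, r)\<in>indices G. real (rank_freq G i j r) * w i j r)"
    unfolding total_util_z_eq using assms
    by (intro sum_mono) (auto simp: feasible_iff intro!: mult_left_mono)
  then show ?thesis
    using assms by (simp add: feasible_iff)
qed

lemma feasible_star:
  assumes "total_util G \<noteq> 0"
  shows "feasible G (w_star G) (z_star G)"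
proof -
  have "0 \<le> z_star G"
    using total_util_nonneg by (simp add: z_star_def)
  \<comment> \<open>By \<open>total_util_z_eq\<close> and \<open>w_star_eq\<close>, this is the
    normalization of the candidate weights.\<close>
  moreover have "total_util G * z_star G = 1"
    using assms by (simp add: z_star_def)
  ultimately show ?thesis
    using index_coeff_nonneg unfolding total_util_z_eq by (auto simp: feasible_iff w_star_eq)
qed

lemma optimal_star:
  assumes "total_util G \<noteq> 0"
  shows "optimal G (w_star G) (z_star G)"
proof -
  \<comment> \<open>Strict positivity allows dividing the bound
    \<open>total_util G * z \<le> 1\<close> by \<open>total_util G\<close>.\<close>
  have "0 < total_util G"
    using assms total_util_nonneg by simp
  then have "z \<le> z_star G" if "feasible G w z" for w z
    using feasible_upper_bound[OF that] by (simp add: z_star_def field_simps)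
  then show ?thesis
    using feasible_star[OF assms] by (simp add: optimal_def)
qed

lemma feasible_z_star_unique:
  assumes "total_util G \<noteq> 0" and "feasible G w (z_star G)"
    and "(i, j, r) \<in> indices G" and "0 < rank_freq G i j r"
  shows "w i j r = w_star G i j r"
proof -
  \<comment> \<open>The slacks are weighted by frequency so that their sum is the normalization
    minus \<open>total_util G * z_star G\<close>, that is \<open>1 - 1\<close>. A positive frequency
    can be cancelled at the end; at frequency 0 the slack vanishes whatever the weight is.\<close>
  define slack where
    "slack = (\<lambda>(i, j, r). real (rank_freq G i j r) * (w i j r - index_coeff i j r * z_star G))"
  have "(\<Sum>p\<in>indices G. slack p) =
      (\<Sum>(i, j, r)\<in>indices G. real (rank_freq G i j r) * w i j r) - total_util G * z_star G"
    unfolding total_util_z_eq slack_def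
    by (simp add: case_prod_unfold right_diff_distrib sum_subtractf)
  also have "\<dots> = 0"
    using assms by (simp add: feasible_iff z_star_def)
  finally have "(\<Sum>p\<in>indices G. slack p) = 0" .
  moreover have "0 \<le> slack p" if "p \<in> indices G" for p
    using assms(2) that by (auto simp: slack_def feasible_iff)
  ultimately have "slack (i, j, r) = 0"
    using assms(3) finite_indices by (simp add: sum_nonneg_eq_0_iff)
  then show ?thesis
    using assms(4) by (simp add: slack_def w_star_eq)
qed

end

text \<open>Ties may leave a rank unoccupied. Raising the weight there keeps feasibility, so
  uniqueness is claimed only at positive frequency. If all utility sits on unoccupied ranks,
  \<open>total_util G\<close> is 0 and \<open>z\<close> is unbounded, while \<open>z_star G\<close>
  is 0 by the convention for division.\<close>

theorem theorem5:
  fixes G :: gopa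
  assumes "hybrid_gopa G"
  shows "((\<forall>(i, j, r)\<in>indices G. 0 < rank_freq G i j r) \<longrightarrow> total_util G \<noteq> 0) \<and>
         (total_util G \<noteq> 0 \<longrightarrow>
            optimal G (w_star G) (z_star G) \<and>
            (\<forall>w z. optimal G w z \<longrightarrow>
               z = z_star G \<and>
               (\<forall>(i, j, r)\<in>indices G. 0 < rank_freq G i j r \<longrightarrow> w i j r = w_star G i j r)))"
proof (intro conjI impI allI)
  show "total_util G \<noteq> 0" if "\<forall>(i, j, r)\<in>indices G. 0 < rank_freq G i j r"
    using total_util_pos[OF assms that] by simp
next
  assume T: "total_util G \<noteq> 0"
  show star: "optimal G (w_star G) (z_star G)"
    by (rule optimal_star[OF assms T])
  fix w z
  assume opt: "optimal G w z"
  show z: "z = z_star G"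
    using star opt by (meson optimal_def order_antisym)
  show "\<forall>(i, j, r)\<in>indices G. 0 < rank_freq G i j r \<longrightarrow> w i j r = w_star G i j r"
    using feasible_z_star_unique[OF assms T] opt z by (auto simp: optimal_def)
qed

end
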